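(* Let $n\ge1$, let $\mathcal{X}_p\subseteq\mathbb{Z}_{2^n}$ be any puncturing bit pattern of the polar code of length $2^n$, and let $\mathcal{U}_p$ be the resulting index set of incapable bits. For any $j\in\mathbb{Z}_{2^n}$, if $j\in\mathcal{U}_p$, then $\mathcal{D}_j\subseteq\mathcal{U}_p$. In other words, $\mathcal{U}_p$ complies with binary domination.
   Context: Let $\mathbb{Z}_{2^n}=\{0,1,\ldots,2^n-1\}$ and write $i=\sum_{t=0}^{n-1}i_t2^t$ with $i_t\in\{0,1\}$. Binary domination: $i\preceq j$ iff $i_t\le j_t$ for all $t$. $\mathcal{D}_j=\{k\in\mathbb{Z}_{2^n}:k\preceq j\}$ and $\mathcal{G}_j=\{k\in\mathbb{Z}_{2^n}:j\preceq k\}$. A set $\mathcal{A}\subseteq\mathbb{Z}_{2^n}$ complies with binary domination if either $\mathcal{D}_j\subseteq\mathcal{A}$ for all $j\in\mathcal{A}$, or $\mathcal{G}_j\subseteq\mathcal{A}$ for all $j\in\mathcal{A}$. Puncturing model. The polar code of length $2^n$ encodes $\mathbf{u}\in\mathbb{F}_2^{2^n}$ to $\mathbf{x}=\mathbf{u}\left[\begin{smallmatrix}1&0\\1&1\end{smallmatrix}\right]^{\otimes n}$. A puncturing bit pattern is a set $\mathcal{X}_p\subseteq\mathbb{Z}_{2^n}$ of indices of encoder output bits that are not transmitted. Successive-cancellation (SC) decoding computes LLRs $\alpha_i^{(t)}$ for $i\in\mathbb{Z}_{2^n}$ and stages $t=n,n-1,\ldots,0$, whose zero pattern is governed by: $\alpha_i^{(n)}=0$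 iff $i\in\mathcal{X}_p$; for $t<n$ and $i_t=0$, $\alpha_i^{(t)}=0$ iff at least one of $\alpha_i^{(t+1)},\alpha_{i+2^t}^{(t+1)}$ is zero; for $t<n$ and $i_t=1$, $\alpha_i^{(t)}=0$ iff both $\alpha_{i-2^t}^{(t+1)}$ and $\alpha_i^{(t+1)}$ are zero. The bit $u_j$ is incapable if $\alpha_j^{(0)}=0$, and $\mathcal{U}_p=\{j:\alpha_j^{(0)}=0\}$. *)

theory Defs
  imports Complex_Main
begin

definition idx :: "nat \<Rightarrow> nat set" where
  "idx n = {0..<2 ^ n}"

(* "bit i t" is the binary digit i_t as a truth value; the order on bool is False < True. *)
definition bin_dominated :: "nat \<Rightarrow> nat \<Rightarrow> nat \<Rightarrow> bool" where
  "bin_dominated n i j \<longleftrightarrow> (\<forall>t<n. bit i t \<le> bit j t)"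

definition down_set :: "nat \<Rightarrow> nat \<Rightarrow> nat set" where
  "down_set n j = {k \<in> idx n. bin_dominated n k j}"

definition up_set :: "nat \<Rightarrow> nat \<Rightarrow> nat set" where
  "up_set n j = {k \<in> idx n. bin_dominated n j k}"

definition complies_with_bin_domination :: "nat \<Rightarrow> nat set \<Rightarrow> bool" where
  "complies_with_bin_domination n A \<longleftrightarrow>
     A \<subseteq> idx n \<and> ((\<forall>j\<in>A. down_set n j \<subseteq> A) \<or> (\<forall>j\<in>A. up_set n j \<subseteq> A))"

(* \<alpha> t i is the LLR of index i at stage t.  Stage n holds the channel LLRs, stage 0 those of
   the input bits u_i.  Only the zero pattern of the LLRs is constrained: in particular, the sum
   or difference formed at an index with i_t = 1 is taken to vanish only if both terms do. *)
definition sc_llrs :: "nat \<Rightarrow> nat set \<Rightarrow> (nat \<Rightarrow> nat \<Rightarrow> real) \<Rightarrow> bool" where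
  "sc_llrs n Xp \<alpha> \<longleftrightarrow>
     (\<forall>i\<in>idx n. \<alpha> n i = 0 \<longleftrightarrow> i \<in> Xp) \<and>
     (\<forall>t<n. \<forall>i\<in>idx n. \<not> bit i t \<longrightarrow>
        (\<alpha> t i = 0 \<longleftrightarrow> \<alpha> (t + 1) i = 0 \<or> \<alpha> (t + 1) (i + 2 ^ t) = 0)) \<and>
     (\<forall>t<n. \<forall>i\<in>idx n. bit i t \<longrightarrow>
        (\<alpha> t i = 0 \<longleftrightarrow> \<alpha> (t + 1) (i - 2 ^ t) = 0 \<and> \<alpha> (t + 1) i = 0))"

definition incapable_bits :: "nat \<Rightarrow> (nat \<Rightarrow> nat \<Rightarrow> real) \<Rightarrow> nat set" where
  "incapable_bits n \<alpha> = {j \<in> idx n. \<alpha> 0 j = 0}"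

(* The constraints are satisfiable for every puncturing pattern. *)
primrec zero_pattern :: "nat \<Rightarrow> nat set \<Rightarrow> nat \<Rightarrow> nat \<Rightarrow> bool" where
  "zero_pattern n Xp 0 i \<longleftrightarrow> i \<in> Xp"
| "zero_pattern n Xp (Suc s) i \<longleftrightarrow>
     (if bit i (n - Suc s)
      then zero_pattern n Xp s (i - 2 ^ (n - Suc s)) \<and> zero_pattern n Xp s i
      else zero_pattern n Xp s i \<or> zero_pattern n Xp s (i + 2 ^ (n - Suc s)))"

lemma sc_llrs_exist: "\<exists>\<alpha>. sc_llrs n Xp \<alpha>"
proof
  have *: "n - t = Suc (n - Suc t)" "n - Suc (n - Suc t) = t" if "t < n" for t
    using that by auto
  show "sc_llrs n Xp (\<lambda>t i. if zero_pattern n Xp (n - t) i then 0 else 1)"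
    by (auto simp: sc_llrs_def *)
qed

end

theory Submission
  imports Defs
begin

text \<open>
  By downward induction on the stage t, the set of indices whose stage-t LLR vanishes is closed
  under clearing binary digits in positions \<open>\<ge> t\<close>. At stage n this is trivial, since no digit
  below n may change; at stage 0 it is the claim.
\<close>

text \<open>With the range expressed by digits, closure of \<open>idx n\<close> under
  \<open>set_bit\<close> and \<open>unset_bit\<close> needs no arithmetic.\<close>

lemma idx_iff_bits: "i \<in> idx n \<longleftrightarrow> (\<forall>s\<ge>n. \<not> bit i s)"
proof -
  have "i \<in> idx n \<longleftrightarrow> take_bit n i = i"
    by (simp add: idx_def take_bit_nat_eq_self_iff)
  also have "\<dots> \<longleftrightarrow> (\<forall>s\<ge>n. \<not> bit i s)"
    by (metis bit_take_bit_iff bit_eqI not_less)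
  finally show ?thesis .
qed

lemma set_bit_idx: "t < n \<Longrightarrow> i \<in> idx n \<Longrightarrow> set_bit t i \<in> idx n"
  by (auto simp: idx_iff_bits bit_set_bit_iff)

lemma unset_bit_idx: "i \<in> idx n \<Longrightarrow> unset_bit t i \<in> idx n"
  by (auto simp: idx_iff_bits bit_unset_bit_iff)

text \<open>Subtraction on \<open>nat\<close> truncates, so the argument is additive: setting the
  cleared digit again restores \<open>i\<close> and adds exactly \<open>2 ^ t\<close>.\<close>

lemma unset_bit_nat_eq_diff:
  fixes i :: nat
  assumes "bit i t"
  shows "unset_bit t i = i - 2 ^ t"
proof -
  have "set_bit t (unset_bit t i) = i"
    using assms by (auto intro!: bit_eqI simp: bit_set_bit_iff bit_unset_bit_iff)
  then have "unset_bit t i + 2 ^ t = i"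
    by (simp add: set_bit_eq bit_unset_bit_iff)
  then show ?thesis by simp
qed

text \<open>Both partner indices become digit operations, so they can be compared digit by
  digit.\<close>

lemma sc_llrs_zero_iff:
  assumes "sc_llrs n Xp \<alpha>" "t < n" "i \<in> idx n"
  shows "\<alpha> t i = 0 \<longleftrightarrow>
    (if bit i t then \<alpha> (Suc t) (unset_bit t i) = 0 \<and> \<alpha> (Suc t) i = 0
     else \<alpha> (Suc t) i = 0 \<or> \<alpha> (Suc t) (set_bit t i) = 0)"
  using assms by (auto simp: sc_llrs_def set_bit_eq unset_bit_nat_eq_diff)

text \<open>Stages t to n only mix indices that differ in digits \<ge> t. Indices with different
  lower digits depend on disjoint parts of \<open>Xp\<close>, hence the agreement below t.\<close>

lemma sc_llrs_zero_mono:
  assumes "sc_llrs n Xp \<alpha>" "t \<le> n"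
    and "i \<in> idx n" "k \<in> idx n" "\<forall>s<t. bit k s = bit i s"
    and "bin_dominated n k i" "\<alpha> t i = 0"
  shows "\<alpha> t k = 0"
  using assms(2-)
proof (induction t arbitrary: i k rule: inc_induct)
  case base
  have "k = i"
    proof (rule bit_eqI)
    show "bit k s = bit i s" for s
      using base by (cases "s < n") (auto simp: idx_iff_bits)
  qed
  with base show ?case by simp
next
  case (step t)
  note zero_iff = sc_llrs_zero_iff[OF assms(1) \<open>t < n\<close>]
  have dom: "bit i s" if "bit k s" "s < n" for s
    using step.prems(4) that by (auto simp: bin_dominated_def)
  \<comment> \<open>At the next stage agreement must include digit t, so each use has to pair
    indices with equal digit t.\<close>
  have IH: "\<alpha> (Suc t) k' = 0"
    if "\<alpha> (Suc t) i' = 0" "i' \<in> idx n" "k' \<in> idx n"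
      "\<And>s. s \<le> t \<Longrightarrow> bit k' s = bit i' s" "\<And>s. s < n \<Longrightarrow> bit k' s \<Longrightarrow> bit i' s" for i' k'
    by (rule step.IH[of i' k']) (use that in \<open>auto simp: bin_dominated_def less_Suc_eq_le\<close>)
  have agree: "bit k s = bit i s" if "s < t" for s
    using step.prems(3) that by blast
  note idx = step.prems(1,2) set_bit_idx[OF \<open>t < n\<close>] unset_bit_idx
  note bits = bit_set_bit_iff bit_unset_bit_iff le_less agree
  consider "bit i t" "bit k t" | "bit i t" "\<not> bit k t" | "\<not> bit i t" "\<not> bit k t"
    using dom \<open>t < n\<close> by blast
  then show ?case
  proof cases
    case 1
    then have *: "\<alpha> (Suc t) (unset_bit t i) = 0" "\<alpha> (Suc t) i = 0"
      using step.prems(5) zero_iff[OF step.prems(1)] by simp_all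
    have "\<alpha> (Suc t) (unset_bit t k) = 0"
      by (rule IH[OF *(1)]) (use 1 in \<open>auto simp: idx bits dest: dom\<close>)
    moreover have "\<alpha> (Suc t) k = 0"
      by (rule IH[OF *(2)]) (use 1 in \<open>auto simp: idx bits dest: dom\<close>)
    ultimately show ?thesis using 1 zero_iff[OF step.prems(2)] by simp
  next
    \<comment> \<open>Here digit t is really cleared. The conjunction at \<open>i\<close> makes the
      LLR at \<open>unset_bit t i\<close> vanish; that index agrees with \<open>k\<close> in digit
      t, and one zero suffices for the disjunction at \<open>k\<close>.\<close>
    case 2
    then have *: "\<alpha> (Suc t) (unset_bit t i) = 0"
      using step.prems(5) zero_iff[OF step.prems(1)] by simp_all
    have "\<alpha> (Suc t) k = 0"
      by (rule IH[OF *]) (use 2 in \<open>auto simp: idx bits dest: dom\<close>)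
    with 2 show ?thesis using zero_iff[OF step.prems(2)] by simp
  next
    case 3
    then consider "\<alpha> (Suc t) i = 0" | "\<alpha> (Suc t) (set_bit t i) = 0"
      using step.prems(5) zero_iff[OF step.prems(1)] by auto
    \<comment> \<open>Whichever partner of \<open>i\<close> vanishes, the partner of
      \<open>k\<close> with the same digit t vanishes too.\<close>
    then have "\<alpha> (Suc t) k = 0 \<or> \<alpha> (Suc t) (set_bit t k) = 0"
    proof cases
      assume *: "\<alpha> (Suc t) i = 0"
      have "\<alpha> (Suc t) k = 0"
        by (rule IH[OF *]) (use 3 in \<open>auto simp: idx bits dest: dom\<close>)
      then show ?thesis ..
    next
      assume *: "\<alpha> (Suc t) (set_bit t i) = 0"
      have "\<alpha> (Suc t) (set_bit t k) = 0"
        by (rule IH[OF *]) (use 3 in \<open>auto simp: idx bits dest: dom\<close>)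
      then show ?thesis ..
    qed
    with 3 show ?thesis using zero_iff[OF step.prems(2)] by simp
  qed
qed

theorem theorem7:
  fixes n :: nat and Xp :: "nat set" and \<alpha> :: "nat \<Rightarrow> nat \<Rightarrow> real"
  assumes "n \<ge> 1"
    and "Xp \<subseteq> idx n"
    and "sc_llrs n Xp \<alpha>"
  shows "(\<forall>j\<in>idx n. j \<in> incapable_bits n \<alpha> \<longrightarrow> down_set n j \<subseteq> incapable_bits n \<alpha>)
         \<and> complies_with_bin_domination n (incapable_bits n \<alpha>)"
proof -
  have "down_set n j \<subseteq> incapable_bits n \<alpha>" if "j \<in> incapable_bits n \<alpha>" for j
    \<comment> \<open>At stage 0 the agreement condition is vacuous, leaving plain
      domination.\<close>
    using that sc_llrs_zero_mono[OF assms(3), of 0 j]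
    by (auto simp: down_set_def incapable_bits_def)
  then show ?thesis
    by (auto simp: complies_with_bin_domination_def incapable_bits_def)
qed

end
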